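(* The map $\operatorname{Li}^{q}$ is a $\mathcal{C}$-algebra homomorphism, i.e. $\operatorname{Li}^q_w(z)\operatorname{Li}^q_v(z)=\operatorname{Li}^q_{w\mathbin{\sqcup\!\sqcup}_q v}(z)$ for $w,v\in\widehat{\mathfrak{H}}^1$.
   Context: Let $\mathcal{C}=\mathbb{Q}[\hbar,\hbar^{-1}]$, $\widehat{\mathfrak{H}}=\mathcal{C}\langle a,b\rangle$, $\widehat{\mathfrak{H}}^1=\mathcal{C}+\widehat{\mathfrak{H}}b$, $e_k=a^kb$. $\mathbb{Q}[[q,z]]$ is a $\mathcal{C}$-algebra with $\hbar$ acting as $1-q$. $[m]_q=(1-q^m)/(1-q)$. The $\mathcal{C}$-linear map $\operatorname{Li}^q:\widehat{\mathfrak{H}}^1\to\mathbb{Q}[[q,z]]$ sends $e_{k_1}\cdots e_{k_r}$ to $\operatorname{Li}^q_{k_1,\dots,k_r}(z)=\sum_{m_1>\cdots>m_r>0}z^{m_1}\prod_{j=1}^r\frac{q^{k_jm_j}}{[m_j]_q^{k_j}}$, and the empty word to $1$. The $q$-shuffle product $\mathbin{\sqcup\!\sqcup}_q$ is defined for letters $\alpha,\beta\in\{a,b\}$ and words $w,v$ by $\alpha w\mathbin{\sqcup\!\sqcup}_q\beta v=\alpha(w\mathbin{\sqcup\!\sqcup}_q\beta v)+\beta(\alpha w\mathbin{\sqcup\!\sqcup}_q v)+(\alpha\diamond_q\beta)(w\mathbin{\sqcup\!\sqcup}_q v)$, ${\bf 1}$ being the unit, where $a\diamond_qb=b\diamond_qa=-ab$,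 $b\diamond_qb=-bb$, $a\diamond_qa=\hbar a$. *)

theory Defs
  imports
    "HOL-Library.Poly_Mapping"
    "HOL-Computational_Algebra.Formal_Power_Series"
    "HOL-Analysis.Infinite_Sum"
begin

text \<open>Laurent polynomials in the variable \<open>\<hbar>\<close> over the rationals are the group algebra of
  the integers; the exponent is the key of the polynomial mapping.\<close>

type_synonym laurent = "int \<Rightarrow>\<^sub>0 rat"

definition hbar :: laurent  (\<open>\<hbar>\<close>)
  where "\<hbar> = Poly_Mapping.single 1 1"

datatype letter = A | B

text \<open>The free monoid on the two letters, written additively because the product of
  \<^typ>\<open>'a \<Rightarrow>\<^sub>0 'b\<close> is the convolution along the addition of \<^typ>\<open>'a\<close>.\<close>

datatype word = Word (letters: "letter list")

instantiation word :: monoid_add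
begin

definition zero_word :: word
  where "0 = Word []"

definition plus_word :: "word \<Rightarrow> word \<Rightarrow> word"
  where "u + v = Word (letters u @ letters v)"

instance
  by standard (simp_all add: zero_word_def plus_word_def)

end

text \<open>With this monoid structure, multiplication on the following type is the concatenation
  product of the free algebra on the letters \<^const>\<open>A\<close> and \<^const>\<open>B\<close>.\<close>

type_synonym ncpoly = "word \<Rightarrow>\<^sub>0 laurent"

definition of_word :: "letter list \<Rightarrow> ncpoly"
  where "of_word w = Poly_Mapping.single (Word w) 1"

abbreviation of_letter :: "letter \<Rightarrow> ncpoly"
  where "of_letter \<alpha> \<equiv> of_word [\<alpha>]"

definition const :: "laurent \<Rightarrow> ncpoly"
  where "const c = Poly_Mapping.single 0 c"

definition Hhat1 :: "ncpoly set"
  where "Hhat1 = {const c + x * of_letter B | c x. True}"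

fun diamond :: "letter \<Rightarrow> letter \<Rightarrow> ncpoly"  (infixl \<open>\<diamondop>\<close> 70)
  where
    "A \<diamondop> B = - (of_letter A * of_letter B)"
  | "B \<diamondop> A = - (of_letter A * of_letter B)"
  | "B \<diamondop> B = - (of_letter B * of_letter B)"
  | "A \<diamondop> A = const \<hbar> * of_letter A"

fun qshuffle_word :: "letter list \<Rightarrow> letter list \<Rightarrow> ncpoly"
  where
    "qshuffle_word [] v = of_word v"
  | "qshuffle_word w [] = of_word w"
  | "qshuffle_word (\<alpha> # w) (\<beta> # v) =
       of_letter \<alpha> * qshuffle_word w (\<beta> # v)
     + of_letter \<beta> * qshuffle_word (\<alpha> # w) v
     + (\<alpha> \<diamondop> \<beta>) * qshuffle_word w v"

definition qshuffle :: "ncpoly \<Rightarrow> ncpoly \<Rightarrow> ncpoly"  (infixl \<open>\<squnion>\<squnion>\<^sub>q\<close> 70)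
  where "x \<squnion>\<squnion>\<^sub>q y =
    (\<Sum>w\<in>Poly_Mapping.keys x. \<Sum>v\<in>Poly_Mapping.keys y.
       const (Poly_Mapping.lookup x w * Poly_Mapping.lookup y v) * qshuffle_word (letters w) (letters v))"

text \<open>Series in \<open>q\<close> and \<open>z\<close> are read as series in \<open>z\<close> whose coefficients are series in \<open>q\<close>.\<close>

type_synonym qzseries = "rat fps fps"

abbreviation qvar :: "rat fps"
  where "qvar \<equiv> fps_X"

abbreviation zvar :: qzseries
  where "zvar \<equiv> fps_X"

definition qint :: "nat \<Rightarrow> rat fps"
  where "qint m = (1 - qvar ^ m) / (1 - qvar)"

text \<open>The structure map of the algebra of series: \<open>\<hbar>\<close> acts as \<open>1 - q\<close>, which is a unit.\<close>

definition laurent_act :: "laurent \<Rightarrow> qzseries"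
  where "laurent_act c =
    (\<Sum>i\<in>Poly_Mapping.keys c. fps_const (fps_const (Poly_Mapping.lookup c i) * (1 - qvar) powi i))"

definition decr_tuples :: "nat \<Rightarrow> nat list set"
  where "decr_tuples r = {m. length m = r \<and> sorted_wrt (>) m \<and> (\<forall>i\<in>set m. 0 < i)}"

definition Li_term :: "nat list \<Rightarrow> nat list \<Rightarrow> qzseries"
  where "Li_term k m =
    zvar ^ hd m *
    fps_const (\<Prod>j<length k. qvar ^ (k ! j * m ! j) / qint (m ! j) ^ (k ! j))"

text \<open>The infinite sum is taken in the \<open>z\<close>-adic topology, which is the one induced by the
  metric on \<^typ>\<open>'a fps\<close>.\<close>

definition Li_index :: "nat list \<Rightarrow> qzseries"
  where "Li_index k =
    (if k = [] then 1 else infsum (Li_term k) (decr_tuples (length k)))"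

definition e_word :: "nat list \<Rightarrow> letter list"
  where "e_word k = concat (map (\<lambda>i. replicate i A @ [B]) k)"

text \<open>The words \<^term>\<open>e_word k\<close> form a basis of \<^const>\<open>Hhat1\<close>, so the sum below runs over the
  expansion of \<open>x\<close> in that basis whenever \<open>x\<close> lies in \<^const>\<open>Hhat1\<close>. Elsewhere the value of
  \<open>Li\<close> is of no significance.\<close>

definition Li :: "ncpoly \<Rightarrow> qzseries"
  where "Li x =
    (\<Sum>k | Word (e_word k) \<in> Poly_Mapping.keys x.
       laurent_act (Poly_Mapping.lookup x (Word (e_word k))) * Li_index k)"

lemma finite_decr_tuples_hd: "finite {m \<in> decr_tuples r. hd m \<le> n}"
proof (rule finite_subset)
  show "{m \<in> decr_tuples r. hd m \<le> n} \<subseteq> {m. set m \<subseteq> {..n} \<and> length m = r}"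
  proof
    fix m assume "m \<in> {m \<in> decr_tuples r. hd m \<le> n}"
    then show "m \<in> {m. set m \<subseteq> {..n} \<and> length m = r}"
      by (cases m) (auto simp: decr_tuples_def)
  qed
qed (simp add: finite_lists_length_eq)

lemma Li_term_has_sum:
  "(Li_term k has_sum
     Abs_fps (\<lambda>n. \<Sum>m | m \<in> decr_tuples (length k) \<and> hd m = n.
       \<Prod>j<length k. qvar ^ (k ! j * m ! j) / qint (m ! j) ^ (k ! j)))
   (decr_tuples (length k))"
  unfolding has_sum_def
proof (rule tendsto_fpsI)
  fix n
  let ?S = "decr_tuples (length k)"
  let ?c = "\<lambda>m. \<Prod>j<length k. qvar ^ (k ! j * m ! j) / qint (m ! j) ^ (k ! j) :: rat fps"
  have fin: "finite {m \<in> ?S. hd m \<le> n}"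
    by (rule finite_decr_tuples_hd)
  have "fps_nth (sum (Li_term k) F) n =
      fps_nth (Abs_fps (\<lambda>n. \<Sum>m | m \<in> ?S \<and> hd m = n. ?c m)) n"
    if F: "finite F" "{m \<in> ?S. hd m \<le> n} \<subseteq> F" "F \<subseteq> ?S" for F
  proof -
    have nth: "fps_nth (Li_term k m) n = (if hd m = n then ?c m else 0)" for m
      by (auto simp: Li_term_def)
    have "fps_nth (sum (Li_term k) F) n = (\<Sum>m\<in>F. if hd m = n then ?c m else 0)"
      by (simp only: fps_sum_nth nth)
    also have "\<dots> = (\<Sum>m\<in>{m \<in> F. hd m = n}. ?c m)"
      using F(1) by (simp only: sum.inter_filter)
    also have "{m \<in> F. hd m = n} = {m. m \<in> ?S \<and> hd m = n}"
      using F by auto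
    finally show ?thesis by simp
  qed
  then show "\<forall>\<^sub>F F in finite_subsets_at_top ?S. fps_nth (sum (Li_term k) F) n =
      fps_nth (Abs_fps (\<lambda>n. \<Sum>m | m \<in> ?S \<and> hd m = n. ?c m)) n"
    unfolding eventually_finite_subsets_at_top using fin
    by (intro exI[of _ "{m \<in> ?S. hd m \<le> n}"]) auto
qed

lemma replicate_A_eq:
  "replicate i A @ B # u = replicate j A @ B # v \<longleftrightarrow> i = j \<and> u = v"
proof (induction i arbitrary: j)
  case 0 then show ?case by (cases j) auto
next
  case (Suc i) then show ?case by (cases j) auto
qed

lemma inj_e_word: "inj e_word"
proof (rule injI)
  show "e_word k = e_word l \<Longrightarrow> k = l" for k l
  proof (induction k arbitrary: l)
    case Nil then show ?case by (cases l) (auto simp: e_word_def)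
  next
    case (Cons i k)
    then show ?case by (cases l) (auto simp: e_word_def replicate_A_eq)
  qed
qed

lemma Li_e_word: "Li (of_word (e_word k)) = Li_index k"
proof -
  have "{l. Word (e_word l) \<in> Poly_Mapping.keys (of_word (e_word k))} = {k}"
    using inj_e_word by (auto simp: of_word_def dest: injD)
  then show ?thesis
    by (simp add: Li_def of_word_def laurent_act_def flip: single_one)
qed

end

theory Submission
  imports Defs
begin

text \<open>Let \<open>a\<close> act on series in \<open>z\<close> by \<open>z\<^sup>n \<mapsto> q\<^sup>n / [n] z\<^sup>n\<close> and \<open>b\<close> by multiplication with
  \<open>z / (1 - z)\<close>. Then \<open>Li\<close> of a word is the value at \<open>1\<close> of the corresponding composition of operators,
  and the three recursive cases of the \<open>q\<close>-shuffle product are product rules for these operators.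
  Those involving \<open>b\<close> hold by commutativity; for two \<open>a\<close>'s on series without constant term they say
  \<open>t\<^sub>i t\<^sub>j = t\<^sub>i\<^sub>+\<^sub>j (t\<^sub>i + t\<^sub>j + 1 - q)\<close> where \<open>t\<^sub>n = q\<^sup>n / [n]\<close>.\<close>

section \<open>Monomials and linear extension\<close>

text \<open>Reduces additive identities to monomials: an update at a fresh key is the addition of a
  monomial.\<close>

lemma poly_mapping_monomial_induct [case_names zero single add]:
  assumes "P 0" "\<And>k c. P (Poly_Mapping.single k c)" "\<And>x y. P x \<Longrightarrow> P y \<Longrightarrow> P (x + y)"
  shows "P x"
proof (induction x rule: update_induct)
  case (update f a b)
  have "Poly_Mapping.update a b f = Poly_Mapping.single a b + f"
    using update(1)
    by (intro poly_mapping_eqI)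
       (auto simp: lookup_update lookup_add lookup_single when_def in_keys_iff)
  then show ?case using update assms by metis
qed (rule assms)

lemma const_add: "const (c + d) = const c + const d"
  by (simp add: const_def single_add)

lemma const_mult: "const (c * d) = const c * const d"
  by (simp add: const_def mult_single)

lemma const_1: "const 1 = 1"
  by (simp add: const_def)

lemma const_mult_single: "const c * Poly_Mapping.single w d = Poly_Mapping.single w (c * d)"
  by (simp add: const_def mult_single)

lemma of_letter_mult_single:
  "of_letter \<alpha> * Poly_Mapping.single w c = Poly_Mapping.single (Word (\<alpha> # letters w)) c"
  by (simp add: of_word_def mult_single plus_word_def)

section \<open>The structure map\<close>

text \<open>Power series do not form a field, and the exponent law fails for \<open>fps_X\<close>,
  whose \<open>inverse\<close> is 0; a nonzero constant coefficient makes \<open>x\<close> a unit.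
  The case of interest is \<open>1 - qvar\<close>.\<close>

lemma power_int_add_unit:
  fixes x :: "'a::field fps"
  assumes "fps_nth x 0 \<noteq> 0"
  shows "x powi (i + j) = x powi i * x powi j"
proof -
  have inv: "x * inverse x = 1"
    using assms by (rule inverse_mult_eq_1')
  have step: "x powi (i + 1) = x powi i * x" for i
  proof (cases "i \<ge> 0")
    case True
    then show ?thesis by (simp add: power_int_def nat_add_distrib)
  next
    case False
    then obtain n where n: "i = - int (Suc n)"
      using negD[of i] by auto
    have "x powi (i + 1) = inverse x ^ n"
      by (cases n) (simp_all add: n power_int_def nat_add_distrib)
    moreover have "x powi i = inverse x ^ Suc n"
      by (simp add: n power_int_def nat_add_distrib)
    moreover have "inverse x ^ Suc n * x = inverse x ^ n"
      using inv by (simp add: algebra_simps)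
    ultimately show ?thesis by simp
  qed
  have unit_step: "x powi (i - 1) = x powi i * inverse x" for i
    using step[of "i - 1"] inv by (simp add: mult.assoc)
  show ?thesis
  proof (induction j rule: int_induct[of _ 0])
    case base
    show ?case by simp
  next
    case (step1 j)
    show ?case using step[of "i + j"] step[of j] step1 by (simp add: algebra_simps)
  next
    case (step2 j)
    show ?case using unit_step[of "i + j"] unit_step[of j] step2 by (simp add: algebra_simps)
  qed
qed

text \<open>The value of \<open>c\<close> at 1 - q is free of z; this is why the structure map
  commutes with the operators of both letters.\<close>

definition hbar_eval :: "laurent \<Rightarrow> rat fps"
  where "hbar_eval c =
    (\<Sum>i\<in>Poly_Mapping.keys c. fps_const (Poly_Mapping.lookup c i) * (1 - qvar) powi i)"

lemma laurent_act_hbar_eval: "laurent_act c = fps_const (hbar_eval c)"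
  by (rule fps_ext) (simp add: laurent_act_def hbar_eval_def fps_sum_nth)

lemma hbar_eval_add: "hbar_eval (c + d) = hbar_eval c + hbar_eval d"
  unfolding hbar_eval_def
  by (rule setsum_keys_plus_distrib) (simp_all add: distrib_right flip: fps_const_add)

lemma hbar_eval_single:
  "hbar_eval (Poly_Mapping.single i r) = fps_const r * (1 - qvar) powi i"
  by (simp add: hbar_eval_def)

lemma hbar_eval_0: "hbar_eval 0 = 0"
  by (simp add: hbar_eval_def)

lemma hbar_eval_mult: "hbar_eval (c * d) = hbar_eval c * hbar_eval d"
proof (induction c rule: poly_mapping_monomial_induct)
  case (single i r)
  show ?case
    by (induction d rule: poly_mapping_monomial_induct)
       (simp_all add: mult_single hbar_eval_0 hbar_eval_add hbar_eval_single power_int_add_unit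
         distrib_left flip: fps_const_mult)
qed (simp_all add: hbar_eval_0 hbar_eval_add distrib_right)

lemma laurent_act_add: "laurent_act (c + d) = laurent_act c + laurent_act d"
  by (simp add: laurent_act_hbar_eval hbar_eval_add)

lemma laurent_act_mult: "laurent_act (c * d) = laurent_act c * laurent_act d"
  by (simp add: laurent_act_hbar_eval hbar_eval_mult)

lemma laurent_act_0: "laurent_act 0 = 0"
  by (simp add: laurent_act_def)

lemma laurent_act_1: "laurent_act 1 = 1"
  by (simp add: laurent_act_hbar_eval hbar_eval_single flip: single_one)

lemma laurent_act_hbar: "laurent_act \<hbar> = fps_const (1 - qvar)"
  by (simp add: laurent_act_hbar_eval hbar_eval_single hbar_def)

section \<open>The operators of the two letters\<close>

text \<open>The value 0 at \<open>n = 0\<close> makes \<open>op_A\<close> kill constant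
  terms.\<close>

definition qratio :: "nat \<Rightarrow> rat fps"
  where "qratio n = (if n = 0 then 0 else qvar ^ n / qint n)"

lemma qint_mult: "qint n * (1 - qvar) = 1 - qvar ^ n"
  using inverse_mult_eq_1[of "1 - qvar :: rat fps"]
  by (simp add: qint_def fps_divide_unit mult.assoc)

lemma qint_nth_0:
  assumes "n > 0"
  shows "fps_nth (qint n) 0 = 1"
  using arg_cong[OF qint_mult[of n], of "\<lambda>f. fps_nth f 0"] assms by simp

lemma qratio_mult: "n > 0 \<Longrightarrow> qratio n * (1 - qvar ^ n) = (1 - qvar) * qvar ^ n"
  using inverse_mult_eq_1[of "qint n"] qint_nth_0[of n]
  by (simp add: qratio_def fps_divide_unit flip: qint_mult)

text \<open>With x = q^i, y = q^j and h = 1 - q, \<open>qratio i\<close> is h x / (1 - x), and the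
  bracket on the right equals h (1 - x y) / ((1 - x) (1 - y)).\<close>

lemma qratio_mult_qratio:
  assumes "i > 0" "j > 0"
  shows "qratio i * qratio j = qratio (i + j) * (qratio i + qratio j + (1 - qvar))"
proof -
  define x :: "rat fps" where "x = qvar ^ i"
  define y :: "rat fps" where "y = qvar ^ j"
  let ?h = "1 - qvar :: rat fps"
  have *: "qratio i * (1 - x) = ?h * x" "qratio j * (1 - y) = ?h * y"
    "qratio (i + j) * (1 - x * y) = ?h * (x * y)"
    using assms by (simp_all add: qratio_mult x_def y_def flip: power_add)
  \<comment> \<open>The denominators have constant coefficient 1. Both sides are multiplied by their
    product, which is cancelled at the end in the integral domain of power series.\<close>
  have nz: "1 - x \<noteq> 0" "1 - y \<noteq> 0" "1 - x * y \<noteq> 0"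
    using assms by (auto simp: x_def y_def fps_eq_iff intro!: exI[of _ 0])
  have "(qratio i * qratio j) * ((1 - x) * (1 - y) * (1 - x * y)) =
    (qratio i * (1 - x)) * (qratio j * (1 - y)) * (1 - x * y)"
    by (simp add: algebra_simps)
  also have "\<dots> = (?h * x) * (?h * y) * (1 - x * y)"
    by (simp add: *)
  also have "\<dots> = ?h * (x * y) * ((?h * x) * (1 - y) + (?h * y) * (1 - x) + ?h * ((1 - x) * (1 - y)))"
    by (simp add: algebra_simps)
  also have "\<dots> = (qratio (i + j) * (1 - x * y)) *
    ((qratio i * (1 - x)) * (1 - y) + (qratio j * (1 - y)) * (1 - x) + ?h * ((1 - x) * (1 - y)))"
    by (simp add: *)
  also have "\<dots> = (qratio (i + j) * (qratio i + qratio j + ?h)) * ((1 - x) * (1 - y) * (1 - x * y))"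
    by (simp add: algebra_simps)
  finally show ?thesis using nz by simp
qed

definition op_A :: "qzseries \<Rightarrow> qzseries"
  where "op_A f = Abs_fps (\<lambda>n. qratio n * fps_nth f n)"

definition op_B :: "qzseries \<Rightarrow> qzseries"
  where "op_B f = Abs_fps (\<lambda>n. if n = 0 then 0 else 1) * f"

lemma op_A_nth: "fps_nth (op_A f) n = qratio n * fps_nth f n"
  by (simp add: op_A_def)

text \<open>Multiplication by z / (1 - z) takes strict partial sums of coefficients; this produces
  the strict inequalities between the summation indices of \<open>Li_index\<close>.\<close>

lemma op_B_nth: "fps_nth (op_B f) n = (\<Sum>i<n. fps_nth f i)"
proof -
  have "fps_nth (op_B f) n = (\<Sum>i=0..n. fps_nth f i * (if n - i = 0 then 0 else 1))"
    by (simp add: op_B_def fps_mult_nth mult.commute[of "Abs_fps _"])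
  also have "\<dots> = (\<Sum>i<n. fps_nth f i)"
    by (rule sum.mono_neutral_cong_right) auto
  finally show ?thesis .
qed

lemma op_A_add: "op_A (f + g) = op_A f + op_A g"
  by (simp add: fps_eq_iff op_A_nth distrib_left)

lemma op_A_0: "op_A 0 = 0"
  by (simp add: fps_eq_iff op_A_nth)

lemma op_A_const: "op_A (fps_const c * f) = fps_const c * op_A f"
  by (rule fps_ext) (simp add: op_A_nth mult.left_commute)

lemma op_B_mult: "op_B f * g = op_B (f * g)" "f * op_B g = op_B (f * g)"
  by (simp_all add: op_B_def ac_simps)

text \<open>In the coefficient of z^n the convolution terms match one by one, by
  \<open>qratio_mult_qratio\<close> at \<open>i\<close> and \<open>n - i\<close>.\<close>

lemma op_A_mult_op_A:
  assumes "fps_nth f 0 = 0" "fps_nth g 0 = 0"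
  shows "op_A f * op_A g = op_A (f * op_A g) + op_A (op_A f * g) + fps_const (1 - qvar) * op_A (f * g)"
proof (rule fps_ext)
  fix n
  have *: "qratio i * fps_nth f i * (qratio (n - i) * fps_nth g (n - i)) =
    qratio n * (fps_nth f i * (qratio (n - i) * fps_nth g (n - i)))
    + qratio n * (qratio i * fps_nth f i * fps_nth g (n - i))
    + (1 - qvar) * (qratio n * (fps_nth f i * fps_nth g (n - i)))" if "i \<le> n" for i
  \<comment> \<open>The two end terms are not covered by that identity; they vanish because
    \<open>f\<close> and \<open>g\<close> have no constant term.\<close>
  proof (cases "i = 0 \<or> i = n")
    case True
    then show ?thesis using assms by auto
  next
    case False
    then have "qratio i * qratio (n - i) = qratio n * (qratio i + qratio (n - i) + (1 - qvar))"
      using qratio_mult_qratio[of i "n - i"] that by simp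
    then have "(qratio i * qratio (n - i)) * (fps_nth f i * fps_nth g (n - i)) =
      (qratio n * (qratio i + qratio (n - i) + (1 - qvar))) * (fps_nth f i * fps_nth g (n - i))"
      by simp
    then show ?thesis by (simp add: algebra_simps)
  qed
  show "fps_nth (op_A f * op_A g) n =
    fps_nth (op_A (f * op_A g) + op_A (op_A f * g) + fps_const (1 - qvar) * op_A (f * g)) n"
    by (simp add: op_A_nth fps_mult_nth[of f] fps_mult_nth[of "op_A f"] sum_distrib_left *
      flip: sum.distrib)
qed

section \<open>The word functional\<close>

fun op_letter :: "letter \<Rightarrow> qzseries \<Rightarrow> qzseries"
  where
    "op_letter A = op_A"
  | "op_letter B = op_B"

definition word_value :: "letter list \<Rightarrow> qzseries"
  where "word_value w = foldr op_letter w 1"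

lemma word_value_simps [simp]:
  "word_value [] = 1"
  "word_value (\<alpha> # w) = op_letter \<alpha> (word_value w)"
  by (simp_all add: word_value_def)

lemma word_value_nth_0: "w \<noteq> [] \<Longrightarrow> fps_nth (word_value w) 0 = 0"
proof (cases w)
  case (Cons \<alpha> v)
  then show ?thesis by (cases \<alpha>) (simp_all add: op_A_nth op_B_nth qratio_def)
qed simp

text \<open>Summing over all words, not only over the \<open>e_word k\<close>, lets left
  multiplication by a letter correspond to its operator without side conditions.\<close>

definition poly_value :: "ncpoly \<Rightarrow> qzseries"
  where "poly_value x =
    (\<Sum>w\<in>Poly_Mapping.keys x. laurent_act (Poly_Mapping.lookup x w) * word_value (letters w))"

lemma poly_value_add: "poly_value (x + y) = poly_value x + poly_value y"
  unfolding poly_value_def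
  by (rule setsum_keys_plus_distrib) (simp_all add: laurent_act_0 laurent_act_add distrib_right)

lemma poly_value_0: "poly_value 0 = 0"
  by (simp add: poly_value_def)

lemma poly_value_minus: "poly_value (- x) = - poly_value x"
  using poly_value_add[of x "- x"] by (simp add: poly_value_0 eq_neg_iff_add_eq_0 add.commute)

lemma poly_value_diff: "poly_value (x - y) = poly_value x - poly_value y"
  using poly_value_add[of x "- y"] by (simp add: poly_value_minus)

lemma poly_value_sum: "poly_value (\<Sum>i\<in>I. f i) = (\<Sum>i\<in>I. poly_value (f i))"
  by (induction I rule: infinite_finite_induct) (simp_all add: poly_value_0 poly_value_add)

lemma poly_value_single:
  "poly_value (Poly_Mapping.single w c) = laurent_act c * word_value (letters w)"
  by (simp add: poly_value_def laurent_act_0)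

lemma poly_value_of_word: "poly_value (of_word w) = word_value w"
  by (simp add: of_word_def poly_value_single laurent_act_1)

lemma poly_value_const: "poly_value (const c * x) = laurent_act c * poly_value x"
  by (induction x rule: poly_mapping_monomial_induct)
     (simp_all add: poly_value_0 poly_value_add poly_value_single const_mult_single
       laurent_act_mult distrib_left mult.assoc)

lemma op_letter_add: "op_letter \<alpha> (f + g) = op_letter \<alpha> f + op_letter \<alpha> g"
  by (cases \<alpha>) (simp_all add: op_A_add op_B_def distrib_left)

lemma op_letter_laurent_act: "op_letter \<alpha> (laurent_act c * f) = laurent_act c * op_letter \<alpha> f"
  by (cases \<alpha>) (simp_all add: laurent_act_hbar_eval op_A_const op_B_def mult.left_commute)

lemma poly_value_of_letter: "poly_value (of_letter \<alpha> * x) = op_letter \<alpha> (poly_value x)"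
proof (induction x rule: poly_mapping_monomial_induct)
  case zero
  show ?case by (cases \<alpha>) (simp_all add: poly_value_0 op_A_0 op_B_def)
next
  case (single w c)
  show ?case by (simp add: of_letter_mult_single poly_value_single op_letter_laurent_act)
next
  case (add x y)
  then show ?case by (simp add: distrib_left poly_value_add op_letter_add)
qed

section \<open>Product rule on admissible words\<close>

definition admissible :: "letter list \<Rightarrow> bool"
  where "admissible w \<longleftrightarrow> w = [] \<or> last w = B"

text \<open>By the second conclusion a leading \<open>A\<close> has a nonempty tail, so
  \<open>op_A\<close> is applied to a series without constant term.\<close>

lemma admissible_Cons: "admissible (\<alpha> # w) \<Longrightarrow> admissible w \<and> (w = [] \<longrightarrow> \<alpha> = B)"
  by (auto simp: admissible_def split: if_splits)

text \<open>Under \<open>poly_value\<close> the recursion of the q-shuffle turns into a product rule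
  for two operators, and tails of admissible words stay admissible.\<close>

lemma poly_value_qshuffle_word:
  assumes "admissible w" "admissible v"
  shows "poly_value (qshuffle_word w v) = word_value w * word_value v"
  using assms
proof (induction w v rule: qshuffle_word.induct)
  case (3 \<alpha> w \<beta> v)
  have adm: "admissible w" "admissible v" "w = [] \<Longrightarrow> \<alpha> = B" "v = [] \<Longrightarrow> \<beta> = B"
    using 3(4,5) admissible_Cons by blast+
  have IH: "poly_value (qshuffle_word w (\<beta> # v)) = word_value w * op_letter \<beta> (word_value v)"
    "poly_value (qshuffle_word (\<alpha> # w) v) = op_letter \<alpha> (word_value w) * word_value v"
    "poly_value (qshuffle_word w v) = word_value w * word_value v"
    using 3 adm by simp_all
  have nth_0: "fps_nth (word_value w) 0 = 0 \<and> fps_nth (word_value v) 0 = 0" if "\<alpha> = A" "\<beta> = A"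
    using that adm word_value_nth_0 by fastforce
  \<comment> \<open>If a \<open>B\<close> is involved, \<open>op_B_mult\<close> pulls it out of
    every product; the diamond term then cancels one of the other two terms, and the remaining one
    is the product. Two \<open>A\<close>s are the case of \<open>op_A_mult_op_A\<close>.\<close>
  show ?case
    using IH nth_0
    by (cases \<alpha>; cases \<beta>)
       (simp_all add: poly_value_add poly_value_diff poly_value_of_letter poly_value_const
         mult.assoc laurent_act_hbar op_A_mult_op_A op_B_mult)
qed (simp_all add: poly_value_of_word)

section \<open>The subalgebra of admissible words\<close>

lemma keys_Hhat1:
  assumes "x \<in> Hhat1" "w \<in> Poly_Mapping.keys x"
  shows "admissible (letters w)"
proof -
  obtain c y where x: "x = const c + y * of_letter B"
    using assms by (auto simp: Hhat1_def)
  have "w \<in> Poly_Mapping.keys (const c) \<union> Poly_Mapping.keys (y * of_letter B)"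
    using assms(2) keys_add[of "const c" "y * of_letter B"] unfolding x by (rule rev_subsetD)
  then consider "w \<in> Poly_Mapping.keys (const c)" | "w \<in> Poly_Mapping.keys (y * of_letter B)"
    by auto
  then show ?thesis
  proof cases
    case 1
    then show ?thesis
      by (simp add: const_def zero_word_def admissible_def split: if_splits)
  next
    case 2
    from subsetD[OF keys_mult 2] obtain u where "w = u + Word [B]"
      by (auto simp: of_word_def)
    then show ?thesis by (simp add: plus_word_def admissible_def)
  qed
qed

text \<open>A right factor b survives multiplication from the left, so it passes from the recursive
  calls to the result.\<close>

lemma qshuffle_word_ends_with_B:
  assumes "admissible w" "admissible v" "w \<noteq> [] \<or> v \<noteq> []"
  shows "\<exists>x. qshuffle_word w v = x * of_letter B"
proof -
  have of_word: "\<exists>x. of_word u = x * of_letter B" if "admissible u" "u \<noteq> []" for u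
  proof -
    have "of_word u = of_word (butlast u) * of_letter B"
      using that append_butlast_last_id[of u]
      by (simp add: admissible_def of_word_def mult_single plus_word_def)
    then show ?thesis by blast
  qed
  show ?thesis
    using assms
  proof (induction w v rule: qshuffle_word.induct)
    case (3 \<alpha> w \<beta> v)
    have adm: "admissible w" "admissible v" "w = [] \<Longrightarrow> \<alpha> = B" "v = [] \<Longrightarrow> \<beta> = B"
      using 3(4,5) admissible_Cons by blast+
    obtain x where x: "qshuffle_word w (\<beta> # v) = x * of_letter B"
      using 3 adm by blast
    obtain y where y: "qshuffle_word (\<alpha> # w) v = y * of_letter B"
      using 3 adm by blast
    obtain z where z: "(\<alpha> \<diamondop> \<beta>) * qshuffle_word w v = z * of_letter B"
    proof (cases "w = [] \<and> v = []")
      case True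
      \<comment> \<open>Here the recursive call yields 1, without a factor b, but both letters are
        \<open>B\<close> and the diamond itself supplies -bb.\<close>
      then have "(\<alpha> \<diamondop> \<beta>) * qshuffle_word w v = - of_letter B * of_letter B"
        using adm by (simp add: of_word_def flip: zero_word_def)
      then show ?thesis using that by blast
    next
      case False
      then obtain u where "qshuffle_word w v = u * of_letter B"
        using 3 adm by blast
      then show ?thesis using that by (simp flip: mult.assoc)
    qed
    have "qshuffle_word (\<alpha> # w) (\<beta> # v) = (of_letter \<alpha> * x + of_letter \<beta> * y + z) * of_letter B"
      by (simp add: x y z distrib_right mult.assoc)
    then show ?case by blast
  qed (use of_word in auto)
qed

section \<open>Closure of \<open>Hhat1\<close> under sums, scalars and the q-shuffle product\<close>

lemma Hhat1_0: "0 \<in> Hhat1"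
  unfolding Hhat1_def by (auto intro!: exI[of _ 0] simp: const_def)

lemma Hhat1_add: "x \<in> Hhat1 \<Longrightarrow> y \<in> Hhat1 \<Longrightarrow> x + y \<in> Hhat1"
proof -
  assume "x \<in> Hhat1" "y \<in> Hhat1"
  then obtain c x' d y' where
    "x = const c + x' * of_letter B" "y = const d + y' * of_letter B"
    by (auto simp: Hhat1_def)
  then have "x + y = const (c + d) + (x' + y') * of_letter B"
    by (simp add: const_add distrib_right)
  then show ?thesis by (auto simp: Hhat1_def)
qed

lemma Hhat1_const_mult: "x \<in> Hhat1 \<Longrightarrow> const c * x \<in> Hhat1"
proof -
  assume "x \<in> Hhat1"
  then obtain d x' where "x = const d + x' * of_letter B"
    by (auto simp: Hhat1_def)
  then have "const c * x = const (c * d) + (const c * x') * of_letter B"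
    by (simp add: const_mult distrib_left mult.assoc)
  then show ?thesis by (auto simp: Hhat1_def)
qed

lemma Hhat1_sum: "(\<And>i. i \<in> I \<Longrightarrow> f i \<in> Hhat1) \<Longrightarrow> (\<Sum>i\<in>I. f i) \<in> Hhat1"
  by (induction I rule: infinite_finite_induct) (simp_all add: Hhat1_0 Hhat1_add)

lemma Hhat1_1: "1 \<in> Hhat1"
proof -
  have "1 = const 1 + 0 * of_letter B"
    by (simp add: const_1)
  then show ?thesis unfolding Hhat1_def by blast
qed

lemma Hhat1_qshuffle_word:
  assumes "admissible w" "admissible v"
  shows "qshuffle_word w v \<in> Hhat1"
proof (cases "w = [] \<and> v = []")
  case True
  then show ?thesis by (simp add: of_word_def Hhat1_1 flip: zero_word_def)
next
  case False
  then obtain x where "qshuffle_word w v = const 0 + x * of_letter B"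
    using qshuffle_word_ends_with_B assms by (fastforce simp: const_def)
  then show ?thesis by (auto simp: Hhat1_def)
qed

lemma Hhat1_qshuffle: "x \<in> Hhat1 \<Longrightarrow> y \<in> Hhat1 \<Longrightarrow> x \<squnion>\<squnion>\<^sub>q y \<in> Hhat1"
  unfolding qshuffle_def
  by (intro Hhat1_sum Hhat1_const_mult Hhat1_qshuffle_word) (auto dest: keys_Hhat1)

lemma poly_value_qshuffle:
  assumes "x \<in> Hhat1" "y \<in> Hhat1"
  shows "poly_value (x \<squnion>\<squnion>\<^sub>q y) = poly_value x * poly_value y"
  unfolding qshuffle_def poly_value_sum poly_value_const poly_value_def[of x] poly_value_def[of y]
    sum_product
  by (intro sum.cong refl)
     (simp add: poly_value_qshuffle_word keys_Hhat1[OF assms(1)] keys_Hhat1[OF assms(2)]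
       laurent_act_mult mult_ac)

section \<open>Multiple polylogarithms as word values\<close>

text \<open>Read from the left, an \<open>A\<close> raises the first index by one and a
  \<open>B\<close> opens a new block of index 0.\<close>

lemma admissible_iff_e_word: "admissible w \<longleftrightarrow> w \<in> range e_word"
proof
  show "w \<in> range e_word" if "admissible w"
    using that
  proof (induction w)
    case Nil
    have "e_word [] = []" by (simp add: e_word_def)
    then show ?case by (metis rangeI)
  next
    case (Cons \<alpha> w)
    then obtain k where k: "w = e_word k" "w = [] \<longrightarrow> \<alpha> = B"
      using admissible_Cons by blast
    show ?case
    proof (cases \<alpha>)
      case A
      \<comment> \<open>An \<open>A\<close> is never the last letter, so there is a first index to
        raise.\<close>
      with k obtain i l where "k = i # l"
        by (cases k) (auto simp: e_word_def)
      then have "\<alpha> # w = e_word (Suc i # l)"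
        by (simp add: A k e_word_def)
      then show ?thesis by blast
    next
      case B
      then have "\<alpha> # w = e_word (0 # k)"
        by (simp add: k e_word_def)
      then show ?thesis by blast
    qed
  qed
next
  have "admissible (e_word k)" for k
    by (induction k) (auto simp: admissible_def e_word_def)
  then show "admissible w" if "w \<in> range e_word"
    using that by blast
qed

section \<open>Coefficients of multiple polylogarithms\<close>

lemma Nil_in_decr_tuples: "[] \<in> decr_tuples r \<longleftrightarrow> r = 0"
  by (auto simp: decr_tuples_def)

lemma decr_tuples_0: "decr_tuples 0 = {[]}"
  by (auto simp: decr_tuples_def)

lemma Cons_in_decr_tuples:
  "n # m \<in> decr_tuples (Suc r) \<longleftrightarrow> m \<in> decr_tuples r \<and> n > 0 \<and> (m = [] \<or> hd m < n)"
  by (cases m) (auto simp: decr_tuples_def)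

text \<open>The z-adic sum is read off coefficientwise. For \<open>k = []\<close> the right-hand
  side would depend on the unspecified \<open>hd []\<close>.\<close>

lemma Li_index_nth:
  assumes "k \<noteq> []"
  shows "fps_nth (Li_index k) n = (\<Sum>m | m \<in> decr_tuples (length k) \<and> hd m = n.
       \<Prod>j<length k. qvar ^ (k ! j * m ! j) / qint (m ! j) ^ (k ! j))"
  using assms infsumI[OF Li_term_has_sum[of k]] by (simp add: Li_index_def)

lemma qratio_power:
  assumes "n > 0"
  shows "qvar ^ (i * n) / qint n ^ i = qratio n ^ i"
  using assms qint_nth_0[of n]
  by (simp add: qratio_def fps_divide_unit fps_nth_power_0 power_mult_distrib fps_inverse_power
    mult.commute[of i] power_mult)

text \<open>Fixing the largest summation index as \<open>n\<close> splits off the factor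
  \<open>qratio n ^ i\<close>; grouping the remaining tuples by their head, which is below
  \<open>n\<close>, gives the partial sum.\<close>

lemma Li_index_Cons_nth:
  "fps_nth (Li_index (i # k)) n = qratio n ^ i * (\<Sum>l<n. fps_nth (Li_index k) l)"
proof -
  let ?c = "\<lambda>k m. \<Prod>j<length k. qvar ^ (k ! j * m ! j) / qint (m ! j) ^ (k ! j) :: rat fps"
  \<comment> \<open>The tails that may follow \<open>n\<close>.\<close>
  define T where "T = {m \<in> decr_tuples (length k). m = [] \<or> hd m < n}"
  \<comment> \<open>Entries of tuples are positive, so no tuple has head 0.\<close>
  have idx: "{m. m \<in> decr_tuples (length (i # k)) \<and> hd m = n} = (if n = 0 then {} else (#) n ` T)"
  proof (rule set_eqI)
    fix m
    show "m \<in> {m. m \<in> decr_tuples (length (i # k)) \<and> hd m = n} \<longleftrightarrow>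
      m \<in> (if n = 0 then {} else (#) n ` T)"
      by (cases m) (auto simp: T_def Cons_in_decr_tuples Nil_in_decr_tuples)
  qed
  have nth: "fps_nth (Li_index (i # k)) n = (\<Sum>m\<in>(if n = 0 then {} else (#) n ` T). ?c (i # k) m)"
    unfolding idx[symmetric] by (rule Li_index_nth) simp
  show ?thesis
  proof (cases "n = 0")
    case True
    then show ?thesis unfolding nth by simp
  next
    case False
    have "fps_nth (Li_index (i # k)) n = (\<Sum>m\<in>T. ?c (i # k) (n # m))"
      unfolding nth using False by (simp add: sum.reindex del: prod.lessThan_Suc)
    also have "\<dots> = (\<Sum>m\<in>T. qratio n ^ i * ?c k m)"
      using False by (simp add: prod.lessThan_Suc_shift qratio_power del: prod.lessThan_Suc)
    also have "\<dots> = qratio n ^ i * (\<Sum>m\<in>T. ?c k m)"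
      by (rule sum_distrib_left[symmetric])
    also have "(\<Sum>m\<in>T. ?c k m) = (\<Sum>l<n. fps_nth (Li_index k) l)"
    proof (cases "k = []")
      case True
      \<comment> \<open>The empty tail contributes the empty product 1, matching the constant series
        \<open>Li_index []\<close>, whose partial sum is 1 because \<open>n\<close> is
        positive.\<close>
      then have "T = {[]}" by (auto simp: T_def decr_tuples_0)
      moreover have "(\<Sum>l<n. fps_nth (1 :: qzseries) l) = 1"
        using False by simp
      ultimately show ?thesis using True by (simp add: Li_index_def)
    next
      case k: False
      then have T: "T = {m \<in> decr_tuples (length k). hd m < n}"
        by (auto simp: T_def Nil_in_decr_tuples)
      have fin: "finite T"
        by (rule finite_subset[OF _ finite_decr_tuples_hd[of "length k" n]]) (auto simp: T)
      have "(\<Sum>m\<in>T. ?c k m) = (\<Sum>l<n. \<Sum>m\<in>{m \<in> T. hd m = l}. ?c k m)"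
        by (rule sum.group[symmetric]) (use fin in \<open>auto simp: T\<close>)
      also have "\<dots> = (\<Sum>l<n. fps_nth (Li_index k) l)"
      proof (rule sum.cong[OF refl])
        fix l assume "l \<in> {..<n}"
        then have "{m \<in> T. hd m = l} = {m. m \<in> decr_tuples (length k) \<and> hd m = l}"
          by (auto simp: T)
        then show "(\<Sum>m\<in>{m \<in> T. hd m = l}. ?c k m) = fps_nth (Li_index k) l"
          by (simp only: Li_index_nth[OF k])
      qed
      finally show ?thesis .
    qed
    finally show ?thesis .
  qed
qed

text \<open>The block a^i b takes strict partial sums and then multiplies the coefficient of z^n by
  \<open>qratio n ^ i\<close>, which is the recursion in \<open>Li_index_Cons_nth\<close>.\<close>

lemma word_value_e_word: "word_value (e_word k) = Li_index k"
proof (induction k)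
  case Nil
  show ?case by (simp add: e_word_def Li_index_def)
next
  case (Cons i k)
  have pow: "fps_nth (word_value (replicate i A @ w)) n = qratio n ^ i * fps_nth (word_value w) n"
    for i w n
    by (induction i) (simp_all add: op_A_nth)
  have "e_word (i # k) = replicate i A @ B # e_word k"
    by (simp add: e_word_def)
  then show ?case
    by (intro fps_ext) (simp add: pow op_B_nth Cons Li_index_Cons_nth)
qed

text \<open>On \<open>Hhat1\<close> every word in the support is a unique \<open>e_word k\<close>,
  so the two sums differ by a reindexing. Elsewhere \<open>Li\<close> drops the words ending in
  \<open>A\<close>.\<close>

lemma Li_eq_poly_value:
  assumes "x \<in> Hhat1"
  shows "Li x = poly_value x"
proof -
  let ?K = "{k. Word (e_word k) \<in> Poly_Mapping.keys x}"
  have "bij_betw (\<lambda>k. Word (e_word k)) ?K (Poly_Mapping.keys x)"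
  proof (rule bij_betw_imageI)
    show "inj_on (\<lambda>k. Word (e_word k)) ?K"
      using inj_e_word by (auto intro!: inj_onI dest: injD)
    have "w \<in> (\<lambda>k. Word (e_word k)) ` ?K" if w: "w \<in> Poly_Mapping.keys x" for w
    proof -
      obtain k where "letters w = e_word k"
        using keys_Hhat1[OF assms w] admissible_iff_e_word by auto
      then have "w = Word (e_word k)" by (metis word.collapse)
      then show ?thesis using w by blast
    qed
    then show "(\<lambda>k. Word (e_word k)) ` ?K = Poly_Mapping.keys x" by auto
  qed
  from sum.reindex_bij_betw[OF this,
      of "\<lambda>w. laurent_act (Poly_Mapping.lookup x w) * word_value (letters w)"]
  show ?thesis by (simp add: Li_def poly_value_def word_value_e_word)
qed

theorem theorem3p18:
  shows "(\<forall>w\<in>Hhat1. \<forall>v\<in>Hhat1. w \<squnion>\<squnion>\<^sub>q v \<in> Hhat1)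
    \<and> (\<forall>w\<in>Hhat1. \<forall>v\<in>Hhat1. Li (w + v) = Li w + Li v)
    \<and> (\<forall>c. \<forall>w\<in>Hhat1. Li (const c * w) = laurent_act c * Li w)
    \<and> Li 1 = 1
    \<and> (\<forall>w\<in>Hhat1. \<forall>v\<in>Hhat1. Li w * Li v = Li (w \<squnion>\<squnion>\<^sub>q v))"
proof -
  have "poly_value 1 = 1"
    using poly_value_of_word[of "[]"] by (simp add: of_word_def flip: zero_word_def)
  then show ?thesis
    \<comment> \<open>By the closure properties every argument of \<open>Li\<close> lies in
      \<open>Hhat1\<close>, so \<open>Li\<close> can be replaced by \<open>poly_value\<close>
      throughout.\<close>
    by (simp add: Li_eq_poly_value Hhat1_qshuffle Hhat1_add Hhat1_const_mult Hhat1_1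
      poly_value_add poly_value_const poly_value_qshuffle)
qed

end
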